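(* Let $G=T_n\langle t_1,\ldots,t_k\rangle$ be a Toeplitz graph with $k\ge 4$ and $t_{k-1}+t_k=n$. Then $G$ is claw-free if and only if $t_i=it_1$ for each $i\in[k-1]$ and $t_k\in\{kt_1,(k+1)t_1\}$. Furthermore, if $n$ is odd, then $G$ is claw-free if and only if $t_i=it_1$ for each $i\in[k]$.
   Context: $[m]=\{1,\ldots,m\}$. For integers $1\le t_1<\cdots<t_k<n$, the Toeplitz graph $T_n\langle t_1,\ldots,t_k\rangle$ is the simple graph with vertex set $[n]$ in which $v$ and $w$ are adjacent if and only if $|v-w|=t_i$ for some $i\in[k]$. A claw is an induced subgraph isomorphic to $K_{1,3}$; a graph is claw-free if it has no claw. *)

theory Defs
  imports "Graph_Theory.Graph_Theory"
begin

text \<open>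
  As in the library, an undirected simple graph is a finite symmetric digraph without loops and
  parallel arcs (locale \<^locale>\<open>graph\<close>). The parameters \<open>t\<^sub>1, \<dots>, t\<^sub>k\<close> are the values of \<open>t\<close> on
  \<open>{1..k}\<close>; other values of \<open>t\<close> are irrelevant. The differences are taken in \<^typ>\<open>int\<close> because
  subtraction on \<^typ>\<open>nat\<close> truncates.
\<close>

definition toeplitz_graph :: "nat \<Rightarrow> nat \<Rightarrow> (nat \<Rightarrow> nat) \<Rightarrow> (nat, nat \<times> nat) pre_digraph" where
  "toeplitz_graph n k t = with_proj
     \<lparr>pverts = {1..n},
      parcs = {(v, w). v \<in> {1..n} \<and> w \<in> {1..n} \<and> (\<exists>i\<in>{1..k}. \<bar>int v - int w\<bar> = int (t i))}\<rparr>"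

lemma graph_toeplitz_graph:
  assumes "\<And>i. i \<in> {1..k} \<Longrightarrow> 1 \<le> t i"
  shows "graph (toeplitz_graph n k t)"
proof -
  let ?G = "\<lparr>pverts = {1..n},
      parcs = {(v, w). v \<in> {1..n} \<and> w \<in> {1..n} \<and> (\<exists>i\<in>{1..k}. \<bar>int v - int w\<bar> = int (t i))}\<rparr>"
  have fin: "finite (parcs ?G)"
    by (rule finite_subset[of _ "{1..n} \<times> {1..n}"]) auto
  have sym: "symmetric (with_proj ?G)"
    by (simp add: symmetric_def sym_def abs_minus_commute)
  have loopfree: "fst e \<noteq> snd e" if "e \<in> parcs ?G" for e
    using that assms by (cases e) fastforce
  have "pair_graph ?G"
    by unfold_locales (use fin sym loopfree in \<open>simp_all add: case_prod_beta\<close>)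
  then interpret pair_graph ?G .
  show ?thesis
    unfolding toeplitz_graph_def by (rule graph_axioms)
qed

text \<open>
  The predicate \<^const>\<open>complete_bipartite_digraph\<close> \<open>1 3\<close> holds of exactly the graphs isomorphic
  to \<open>K\<^bsub>1,3\<^esub>\<close>.
\<close>

definition claw :: "('a, 'b) pre_digraph \<Rightarrow> ('a, 'b) pre_digraph \<Rightarrow> bool" where
  "claw H G \<longleftrightarrow> induced_subgraph H G \<and> complete_bipartite_digraph 1 3 H"

definition claw_free :: "('a, 'b) pre_digraph \<Rightarrow> bool" where
  "claw_free G \<longleftrightarrow> \<not> (\<exists>H. claw H G)"

end

theory Submission
  imports Defs
begin

text \<open>
  Write \<open>D\<close> for the set of the jumps \<open>t\<^sub>1, \<dots>, t\<^sub>k\<close> and \<open>d = t\<^sub>1\<close>, \<open>a = t\<^bsub>k-1\<^esub>\<close>, \<open>b = t\<^sub>k\<close>,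
  \<open>m = k - 2\<close>, so that \<open>n = a + b\<close>.

  If the jumps have the stated form, they are all multiples of \<open>d\<close>, and so the neighbours of a
  vertex are congruent to each other modulo \<open>d\<close>. Two congruent vertices that are not adjacent are
  at least \<open>k * d\<close> apart, because \<open>D\<close> contains all smaller multiples of \<open>d\<close>. Three pairwise
  non-adjacent neighbours would therefore span a distance of at least \<open>2 * k * d\<close>, while
  \<open>n \<le> (k - 1) * d + (k + 1) * d = 2 * k * d\<close>: there is no room for a claw
  (\<open>toeplitz_multiples_claw_free\<close>).

  Conversely, the equation \<open>n = a + b\<close> makes two vertices so central that almost all signed jumps
  are possible from them: vertex \<open>a\<close> has all neighbours \<open>a + t\<^sub>i\<close>, and \<open>a - t\<^sub>i\<close> for \<open>i \<le> m\<close>, while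
  vertex \<open>a + 1\<close> has all neighbours \<open>a + 1 \<plusminus> t\<^sub>i\<close> with \<open>i < k\<close>. Since \<open>b\<close> is the largest jump, the
  neighbour \<open>a + b\<close> of \<open>a\<close> is adjacent to no vertex \<open>a - t\<^sub>i\<close>. Hence the triples with offsets
  \<open>b, - t\<^sub>i, - t\<^sub>j\<close> at \<open>a\<close> give \<open>t\<^sub>j - t\<^sub>i \<in> D\<close> for \<open>i < j \<le> m\<close>, and a set of positive numbers that is
  closed under differences in this way consists of the multiples of its smallest element
  (\<open>difference_closed_imp_multiples\<close>): \<open>t\<^sub>i = i * d\<close> for \<open>i \<le> m\<close>. The triples with offsets
  \<open>b, a, - d\<close> and \<open>b, - i * d, j * d\<close> at \<open>a\<close>, and \<open>a, - a, j * d\<close> at \<open>a + 1\<close>, then leave only the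
  stated values of \<open>a\<close> and \<open>b\<close> (\<open>last_two_jumps\<close>).

  The claim on odd \<open>n\<close> follows because \<open>t\<^sub>k = (k + 1) * d\<close> gives the even number \<open>n = 2 * k * d\<close>.
\<close>

section \<open>Claws in terms of adjacency\<close>

lemma claw_free_iff:
  assumes "graph G"
  shows "claw_free G \<longleftrightarrow>
    (\<forall>c x y z. c \<rightarrow>\<^bsub>G\<^esub> x \<and> c \<rightarrow>\<^bsub>G\<^esub> y \<and> c \<rightarrow>\<^bsub>G\<^esub> z \<and> x \<noteq> y \<and> x \<noteq> z \<and> y \<noteq> z
       \<longrightarrow> x \<rightarrow>\<^bsub>G\<^esub> y \<or> x \<rightarrow>\<^bsub>G\<^esub> z \<or> y \<rightarrow>\<^bsub>G\<^esub> z)"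
proof -
  interpret graph G by fact
  have induced_adj: "u \<rightarrow>\<^bsub>H\<^esub> w \<longleftrightarrow> u \<rightarrow>\<^bsub>G\<^esub> w"
    if "induced_subgraph H G" "u \<in> verts H" "w \<in> verts H" for H u w
    using that unfolding induced_subgraph_def subgraph_def compatible_def
    by (auto simp: arcs_ends_conv image_iff)
  have "\<exists>c x y z. c \<rightarrow>\<^bsub>G\<^esub> x \<and> c \<rightarrow>\<^bsub>G\<^esub> y \<and> c \<rightarrow>\<^bsub>G\<^esub> z \<and> x \<noteq> y \<and> x \<noteq> z \<and> y \<noteq> z
      \<and> \<not> x \<rightarrow>\<^bsub>G\<^esub> y \<and> \<not> x \<rightarrow>\<^bsub>G\<^esub> z \<and> \<not> y \<rightarrow>\<^bsub>G\<^esub> z" if cl: "claw H G" for H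
  proof -
    have ind: "induced_subgraph H G"
      using cl by (simp add: claw_def)
    obtain U V where UV: "verts H = U \<union> V" "U \<inter> V = {}" "card U = 1" "card V = 3"
        "arcs_ends H = U \<times> V \<union> V \<times> U"
      using cl by (auto simp: claw_def complete_bipartite_digraph_def)
    obtain c where c: "U = {c}"
      using UV(3) by (auto simp: card_1_singleton_iff)
    obtain x y z where V: "V = {x, y, z}" "x \<noteq> y" "x \<noteq> z" "y \<noteq> z"
      using UV(4) by (auto simp: card_3_iff)
    \<comment> \<open>The complete bipartite graph fixes adjacency and non-adjacency on its four vertices.\<close>
    have star: "u \<rightarrow>\<^bsub>G\<^esub> w \<longleftrightarrow> (u, w) \<in> {c} \<times> {x, y, z} \<union> {x, y, z} \<times> {c}"
      if "u \<in> {c, x, y, z}" "w \<in> {c, x, y, z}" for u w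
      using induced_adj[OF ind, of u w] that UV c V by auto
    show ?thesis
      by (rule exI[of _ c], rule exI[of _ x], rule exI[of _ y], rule exI[of _ z])
        (use star V UV(2) c in auto)
  qed
  moreover have "claw (G \<restriction> {c, x, y, z}) G"
    if adj: "c \<rightarrow>\<^bsub>G\<^esub> x" "c \<rightarrow>\<^bsub>G\<^esub> y" "c \<rightarrow>\<^bsub>G\<^esub> z"
      and ne: "x \<noteq> y" "x \<noteq> z" "y \<noteq> z"
      and nadj: "\<not> x \<rightarrow>\<^bsub>G\<^esub> y" "\<not> x \<rightarrow>\<^bsub>G\<^esub> z" "\<not> y \<rightarrow>\<^bsub>G\<^esub> z" for c x y z
  proof -
    let ?H = "G \<restriction> {c, x, y, z}"
    have ind: "induced_subgraph ?H G"
      using adj adj_in_verts by (intro induced_induce) auto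
    have sym: "u \<rightarrow>\<^bsub>G\<^esub> w \<longleftrightarrow> w \<rightarrow>\<^bsub>G\<^esub> u" for u w
      by (meson graph_symmetric)
    have irrefl: "\<not> u \<rightarrow>\<^bsub>G\<^esub> u" for u
      by (meson adj_not_same)
    have arcs: "arcs_ends ?H = {(u, w). u \<rightarrow>\<^bsub>G\<^esub> w \<and> u \<in> {c, x, y, z} \<and> w \<in> {c, x, y, z}}"
      by (auto simp: arcs_ends_conv image_iff)
    have "arcs_ends ?H = {c} \<times> {x, y, z} \<union> {x, y, z} \<times> {c}"
      unfolding arcs using adj nadj sym irrefl by auto
    moreover have "graph ?H"
      using digraphI_induced[OF ind] induced_graph_imp_graph[OF ind] by (simp add: graph_def pseudo_graph_def digraph_def)
    moreover have "{c} \<inter> {x, y, z} = {}" "card {x, y, z} = 3"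
      using adj irrefl ne by auto
    moreover have "verts ?H = {c} \<union> {x, y, z}" "card {c} = 1"
      by auto
    ultimately have "K\<^bsub>1,3\<^esub> ?H"
      unfolding complete_bipartite_digraph_def by blast
    then show ?thesis
      unfolding claw_def using ind by blast
  qed
  ultimately show ?thesis
    unfolding claw_free_def by blast
qed

text \<open>The jumps are integers because they are compared with differences of vertices.\<close>

definition jumps :: "nat \<Rightarrow> (nat \<Rightarrow> nat) \<Rightarrow> int set" where
  "jumps k t = (\<lambda>i. int (t i)) ` {1..k}"

lemma toeplitz_adj_iff:
  "u \<rightarrow>\<^bsub>toeplitz_graph n k t\<^esub> w \<longleftrightarrow>
     u \<in> {1..n} \<and> w \<in> {1..n} \<and> \<bar>int u - int w\<bar> \<in> jumps k t"
  by (auto simp: toeplitz_graph_def jumps_def)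

text \<open>
  Adjacency depends only on differences, so the neighbours of a vertex \<open>v\<close> are described by their
  signed offsets from \<open>v\<close>. The position of \<open>v\<close> matters only in deciding which offsets stay inside
  the vertex set.
\<close>

lemma toeplitz_claw_free_jumps:
  assumes "claw_free (toeplitz_graph n k t)"
    and pos: "\<And>i. i \<in> {1..k} \<Longrightarrow> 1 \<le> t i"
    and "v \<in> {1..int n}" "v + x \<in> {1..int n}" "v + y \<in> {1..int n}" "v + z \<in> {1..int n}"
    and "\<bar>x\<bar> \<in> jumps k t" "\<bar>y\<bar> \<in> jumps k t" "\<bar>z\<bar> \<in> jumps k t"
    and "x \<noteq> y" "x \<noteq> z" "y \<noteq> z"
  shows "\<bar>x - y\<bar> \<in> jumps k t \<or> \<bar>x - z\<bar> \<in> jumps k t \<or> \<bar>y - z\<bar> \<in> jumps k t"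
proof -
  let ?G = "toeplitz_graph n k t"
  have "graph ?G"
    using pos by (rule graph_toeplitz_graph)
  moreover have "nat v \<rightarrow>\<^bsub>?G\<^esub> nat (v + x)" "nat v \<rightarrow>\<^bsub>?G\<^esub> nat (v + y)" "nat v \<rightarrow>\<^bsub>?G\<^esub> nat (v + z)"
    unfolding toeplitz_adj_iff using assms(3-9) by auto
  moreover have "nat (v + x) \<noteq> nat (v + y)" "nat (v + x) \<noteq> nat (v + z)" "nat (v + y) \<noteq> nat (v + z)"
    using assms by auto
  ultimately have "nat (v + x) \<rightarrow>\<^bsub>?G\<^esub> nat (v + y) \<or> nat (v + x) \<rightarrow>\<^bsub>?G\<^esub> nat (v + z)
      \<or> nat (v + y) \<rightarrow>\<^bsub>?G\<^esub> nat (v + z)"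
    using assms(1) claw_free_iff by blast
  then show ?thesis
    unfolding toeplitz_adj_iff using assms(4-6) by auto
qed

section \<open>Multiples of the first jump leave no room for a claw\<close>

text \<open>
  A common neighbour forces three vertices into one residue class modulo \<open>t 1\<close>. Inside a class,
  distinct non-adjacent vertices are at distance at least \<open>k * t 1\<close>, so three of them need more
  than \<open>2 * k * t 1\<close> vertices.
\<close>

lemma toeplitz_multiples_claw_free:
  assumes d: "1 \<le> t 1"
    and mult: "\<forall>i\<in>{1..k - 1}. t i = i * t 1" and dvd: "t 1 dvd t k"
    and "1 \<le> t k" and n: "n \<le> 2 * k * t 1"
  shows "claw_free (toeplitz_graph n k t)"
proof -
  let ?D = "jumps k t" and ?d = "int (t 1)"
  have pos: "1 \<le> t i" if "i \<in> {1..k}" for i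
    using that bspec[OF mult, of i] d \<open>1 \<le> t k\<close> by (cases "i = k") auto
  have dvd_jump: "?d dvd x" if x: "\<bar>x\<bar> \<in> ?D" for x
  proof -
    obtain i where "i \<in> {1..k}" "\<bar>x\<bar> = int (t i)"
      using x by (auto simp: jumps_def)
    moreover have "t 1 dvd t i"
      using \<open>i \<in> {1..k}\<close> bspec[OF mult, of i] dvd by (cases "i = k") auto
    ultimately have "?d dvd \<bar>x\<bar>"
      by simp
    then show ?thesis by simp
  qed
  have gap: "int k * ?d \<le> y - x" if xy: "x < y" "?d dvd y - x" "\<bar>x - y\<bar> \<notin> ?D" for x y
  proof (rule ccontr)
    obtain c where c: "y - x = ?d * c"
      using xy(2) by blast
    assume "\<not> int k * ?d \<le> y - x"
    then have "c < int k"
      using c mult_right_mono[of "int k" c ?d] by (smt (verit) mult.commute of_nat_0_le_iff)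
    moreover have "0 < c"
      using c d xy(1) zero_less_mult_pos[of ?d c] by linarith
    ultimately have "nat c \<in> {1..k - 1}" "int (nat c) = c"
      by auto
    moreover from this have "\<bar>x - y\<bar> = int (t (nat c))"
      using bspec[OF mult, of "nat c"] c xy(1) by (simp add: mult.commute)
    moreover from \<open>nat c \<in> {1..k - 1}\<close> have "nat c \<in> {1..k}"
      by auto
    ultimately show False
      using xy(3) unfolding jumps_def by blast
  qed
  have spread: False
    if "x < y" "y < z" "1 \<le> x" "z \<le> int n" "?d dvd y - x" "?d dvd z - y"
      "\<bar>x - y\<bar> \<notin> ?D" "\<bar>y - z\<bar> \<notin> ?D" for x y z
  proof -
    have "2 * int k * ?d \<le> z - x"
      using gap[of x y] gap[of y z] that by (simp add: algebra_simps)
    moreover have "int n \<le> 2 * int k * ?d"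
      using n by (metis of_nat_le_iff of_nat_mult of_nat_numeral)
    ultimately show False
      using that by linarith
  qed
  have "x \<rightarrow>\<^bsub>toeplitz_graph n k t\<^esub> y \<or> x \<rightarrow>\<^bsub>toeplitz_graph n k t\<^esub> z \<or> y \<rightarrow>\<^bsub>toeplitz_graph n k t\<^esub> z"
    if adj: "v \<rightarrow>\<^bsub>toeplitz_graph n k t\<^esub> x" "v \<rightarrow>\<^bsub>toeplitz_graph n k t\<^esub> y" "v \<rightarrow>\<^bsub>toeplitz_graph n k t\<^esub> z"
      and ne: "x \<noteq> y" "x \<noteq> z" "y \<noteq> z" for v x y z
  proof (rule ccontr)
    assume non: "\<not> ?thesis"
    have same: "?d dvd int q - int p"
      if "v \<rightarrow>\<^bsub>toeplitz_graph n k t\<^esub> p" "v \<rightarrow>\<^bsub>toeplitz_graph n k t\<^esub> q" for p q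
      using dvd_diff[OF dvd_jump dvd_jump, of "int v - int p" "int v - int q"] that
      unfolding toeplitz_adj_iff by auto
    have order: "\<not> (p < q \<and> q < r)"
      if "p \<in> {x, y, z}" "q \<in> {x, y, z}" "r \<in> {x, y, z}" for p q r
    proof
      assume pqr: "p < q \<and> q < r"
      have nbr: "v \<rightarrow>\<^bsub>toeplitz_graph n k t\<^esub> p" "v \<rightarrow>\<^bsub>toeplitz_graph n k t\<^esub> q"
        "v \<rightarrow>\<^bsub>toeplitz_graph n k t\<^esub> r"
        using that adj by auto
      have "\<bar>int p - int q\<bar> \<notin> ?D" "\<bar>int q - int r\<bar> \<notin> ?D"
        using non that pqr adj unfolding toeplitz_adj_iff
        by (auto simp: abs_minus_commute)
      then show False
        using spread[of "int p" "int q" "int r"] pqr nbr same[of p q] same[of q r]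
        unfolding toeplitz_adj_iff by auto
    qed
    show False
      using order[of x y z] order[of x z y] order[of y x z] order[of y z x]
        order[of z x y] order[of z y x] ne by auto
  qed
  moreover have "graph (toeplitz_graph n k t)"
    using pos by (rule graph_toeplitz_graph)
  ultimately show ?thesis
    using claw_free_iff by blast
qed

section \<open>Claw-freeness determines the jumps\<close>

text \<open>
  Both \<open>t (j + 1) - t 1\<close> and \<open>t (j + 1) - t j\<close> are values of \<open>t\<close>. The former is smaller than
  \<open>t (j + 1)\<close>, hence at most \<open>t j\<close>; the latter is at least \<open>t 1\<close>. So consecutive values differ by
  exactly \<open>t 1\<close>. The differences are values of \<open>t\<close> on the longer range \<open>{1..k}\<close>, as this is what
  adjacency provides; their size brings the index back into \<open>{1..m}\<close>.
\<close>

lemma difference_closed_imp_multiples: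
  fixes t :: "nat \<Rightarrow> nat"
  assumes mono: "strict_mono_on {1..k} t" and "m \<le> k"
    and diff: "\<And>i j. 1 \<le> i \<Longrightarrow> i < j \<Longrightarrow> j \<le> m \<Longrightarrow> \<exists>l\<in>{1..k}. t j - t i = t l"
    and pos: "1 \<le> t 1" and "1 \<le> j" "j \<le> m"
  shows "t j = j * t 1"
  using \<open>1 \<le> j\<close> \<open>j \<le> m\<close>
proof (induction j rule: nat_induct_at_least)
  case base
  then show ?case by simp
next
  case (Suc j)
  have le: "t p \<le> t q" if "1 \<le> p" "p \<le> q" "q \<le> k" for p q
    using strict_mono_on_leD[OF mono, of p q] that by auto
  have less: "t j < t (Suc j)"
    using strict_mono_onD[OF mono, of j "Suc j"] Suc \<open>m \<le> k\<close> by auto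
  obtain l where l: "l \<in> {1..k}" "t (Suc j) - t 1 = t l"
    using diff[of 1 "Suc j"] Suc by auto
  have "t l < t (Suc j)"
    using l(2) pos less by linarith
  then have "l \<le> j"
    using le[of "Suc j" l] l(1) by fastforce
  then have upper: "t (Suc j) - t 1 \<le> t j"
    using l le[of l j] Suc \<open>m \<le> k\<close> by auto
  obtain l' where "l' \<in> {1..k}" "t (Suc j) - t j = t l'"
    using diff[of j "Suc j"] Suc by auto
  then have "t 1 \<le> t (Suc j) - t j"
    using le[of 1 l'] by auto
  with upper less have "t (Suc j) = t j + t 1"
    by linarith
  then show ?case
    using Suc by auto
qed

text \<open>
  The hypotheses \<open>b_star\<close>, \<open>b_minus_a\<close> and \<open>a_star\<close> say that certain triples of neighbours are not
  claws, with offsets \<open>b, - i * d, j * d\<close>, with \<open>b, a, - d\<close>, and with \<open>a, - a, j * d\<close>; the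
  difference \<open>b + i * d\<close> is absent because it exceeds every element of \<open>D\<close>. By
  \<open>b_minus_a\<close>, either \<open>b = 2 * a\<close> or \<open>b = a + q * d\<close> with \<open>q \<le> m\<close>.

  In the first case \<open>b - m * d\<close> lies strictly between \<open>a\<close> and \<open>b\<close>, so \<open>b_star\<close> puts \<open>(m + 1) * d\<close>
  and \<open>(m + 2) * d\<close> into \<open>D\<close>; these would have to be \<open>a\<close> and \<open>2 * a\<close>, which is impossible.
  In the second case \<open>a_star\<close> shows that \<open>a - j * d\<close> is one of the small multiples of \<open>d\<close> for
  each \<open>j \<noteq> q\<close>. This makes \<open>a\<close> a multiple of \<open>d\<close> just above \<open>m * d\<close>, and \<open>b_star\<close> excludes the
  values that are too large.
\<close>

lemma last_two_jumps:
  fixes a b d m :: int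
  defines "D \<equiv> (\<lambda>j. j * d) ` {1..m} \<union> {a, b}"
  assumes d: "0 < d" and m: "2 \<le> m" and a: "m * d < a" and b: "a < b"
    and b_star: "\<And>i j. i \<in> {1..m} \<Longrightarrow> j \<in> {1..m} \<Longrightarrow> b - j * d \<in> D \<or> (i + j) * d \<in> D"
    and b_minus_a: "b - a \<in> D"
    and a_star: "\<And>j. j \<in> {1..m} \<Longrightarrow> 2 * a \<in> D \<or> a - j * d \<in> D \<or> a + j * d \<in> D"
  shows "a = (m + 1) * d \<and> b \<in> {(m + 2) * d, (m + 3) * d}"
proof -
  have large: "x = a \<or> x = b" if "x \<in> D" "m * d < x" for x
    using that d by (auto simp: D_def mult_less_cancel_right)
  have small: "\<exists>i\<in>{1..m}. x = i * d" if "x \<in> D" "x < a" for x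
    using that b by (auto simp: D_def)
  have big_mult: "m * d < c * d" if "m < c" for c
    using that d by simp
  have cancel: "c * d = e * d \<longleftrightarrow> c = e" for c e
    using d by simp
  have apos: "0 < a" "0 < b"
    using d m a b by (smt (verit) mult_pos_pos)+
  have "b - a \<noteq> b"
    using apos by simp
  then consider (double) "b = 2 * a" | (shift) q where "q \<in> {1..m}" "b = a + q * d"
    using b_minus_a b unfolding D_def by force
  then show ?thesis
  proof cases
    case double
    have md: "b - m * d \<notin> D"
      using large[of "b - m * d"] double a d m by (smt (verit) mult_pos_pos)
    have "(1 + m) * d \<in> D"
      using b_star[of 1 m] md m by auto
    then have "(m + 1) * d = a \<or> (m + 1) * d = b"
      using large[of "(1 + m) * d"] big_mult[of "m + 1"] by (auto simp: add.commute)
    moreover have "(m + 1) * d \<le> (2 * m) * d"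
      using m d by (intro mult_right_mono) auto
    ultimately have a_eq: "a = (m + 1) * d"
      using double a by (auto simp: mult.assoc)
    have "(2 + m) * d \<in> D"
      using b_star[of 2 m] md m by auto
    then have "(2 + m) * d = (m + 1) * d \<or> (2 + m) * d = (2 * (m + 1)) * d"
      using large[of "(2 + m) * d"] big_mult[of "2 + m"] a_eq double by (auto simp: mult.assoc)
    then show ?thesis
      unfolding cancel using m by auto
  next
    case shift
    have qd: "q * d \<le> m * d"
      using shift d by simp
    have "2 * a \<notin> D"
      using large[of "2 * a"] shift qd a apos by auto
    then have a_minus: "a - j * d \<in> D" if "j \<in> {1..m}" "j \<noteq> q" for j
    proof -
      have jd: "0 < j * d" "j * d \<noteq> q * d"
        using that d by auto
      then have "a + j * d \<notin> D"
        using large[of "a + j * d"] a shift by auto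
      then show ?thesis
        using a_star[OF that(1)] \<open>2 * a \<notin> D\<close> by blast
    qed
    have a_mult: "\<exists>l\<in>{1..m}. a = (l + j) * d" if j: "j \<in> {1..m}" "j \<noteq> q" for j
    proof -
      have "a - j * d < a"
        using j d by auto
      then obtain l where "l \<in> {1..m}" "a - j * d = l * d"
        using small[OF a_minus[OF j]] by blast
      then show ?thesis
        by (intro bexI[of _ l]) (auto simp: algebra_simps)
    qed
    \<comment> \<open>The index \<open>j = 1\<close> gives the sharp bound; if \<open>q = 1\<close>, only \<open>j = 2\<close> is at hand, and it also
      allows \<open>a = (m + 2) * d\<close>.\<close>
    have a_eq: "a = (m + 1) * d"
    proof (cases "q = 1")
      case False
      obtain l where l: "l \<in> {1..m}" "a = (l + 1) * d"
        using a_mult[of 1] False m by auto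
      then have "m * d < (l + 1) * d"
        using a by simp
      then have "m < l + 1"
        using d by (simp add: mult_less_cancel_right)
      then show ?thesis
        using l by auto
    next
      case True
      obtain l where l: "l \<in> {1..m}" "a = (l + 2) * d"
        using a_mult[of 2] True m by auto
      then have "m * d < (l + 2) * d"
        using a by simp
      then have "m < l + 2"
        using d by (simp add: mult_less_cancel_right)
      then consider "l = m - 1" | "l = m"
        using l(1) by fastforce
      then show ?thesis
      proof cases
        case 1
        then show ?thesis using l by (simp add: add.commute)
      next
        case 2
        have ab: "a = (m + 2) * d" "b = (m + 3) * d"
          using 2 l shift True by (auto simp: algebra_simps)
        \<comment> \<open>Now \<open>(m + 1) * d\<close> is a gap of \<open>D\<close>, and it equals both \<open>(i + j) * d\<close> and \<open>b - j * d\<close> for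
          \<open>i = m - 1\<close> and \<open>j = 2\<close>: the offsets \<open>b, - i * d, j * d\<close> form a claw.\<close>
        have "(m + 1) * d \<notin> D"
          using large[of "(m + 1) * d"] big_mult[of "m + 1"] unfolding ab cancel by auto
        moreover have "b - 2 * d = (m + 1) * d"
          using ab by (simp add: algebra_simps)
        ultimately have False
          using b_star[of "m - 1" 2] m by (auto simp: add.commute)
        then show ?thesis ..
      qed
    qed
    have b_eq: "b = (m + 1 + q) * d"
      using shift a_eq by (simp add: algebra_simps)
    have "q \<le> 2"
    proof (rule ccontr)
      assume q: "\<not> q \<le> 2"
      \<comment> \<open>Above \<open>(m + 1) * d\<close>, the only multiple of \<open>d\<close> in \<open>D\<close> is \<open>b\<close>. So \<open>i = m\<close> and \<open>j = 2\<close> give a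
        claw: \<open>b - 2 * d\<close> is still larger than \<open>a\<close>, and \<open>(m + 2) * d\<close> is smaller than \<open>b\<close>.\<close>
      have "c * d \<notin> D" if "m + 1 < c" "c \<noteq> m + 1 + q" for c
        using large[of "c * d"] big_mult[of c] that unfolding a_eq b_eq cancel by auto
      from this[of "m + 2"] this[of "m + q - 1"]
      have "(m + 2) * d \<notin> D" "b - 2 * d \<notin> D"
        using q b_eq by (auto simp: algebra_simps)
      then show False
        using b_star[of m 2] m by auto
    qed
    then have "q = 1 \<or> q = 2"
      using shift by auto
    then show ?thesis
      using a_eq b_eq by (auto simp: algebra_simps)
  qed
qed

text \<open>
  All triples are taken at the vertices \<open>a = t (k - 1)\<close> and \<open>a + 1\<close>. The offset \<open>b = t k\<close> is
  possible from \<open>a\<close> because \<open>n = a + b\<close>, and the offset \<open>- a\<close> is possible only from \<open>a + 1\<close> on.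
\<close>

lemma toeplitz_claw_free_imp_multiples:
  assumes k: "4 \<le> k" and pos1: "1 \<le> t 1" and mono: "strict_mono_on {1..k} t"
    and n: "t (k - 1) + t k = n"
    and free: "claw_free (toeplitz_graph n k t)"
  shows "(\<forall>i\<in>{1..k - 1}. t i = i * t 1) \<and> t k \<in> {k * t 1, (k + 1) * t 1}"
proof -
  let ?D = "jumps k t" and ?T = "\<lambda>i. int (t i)"
  define a b where "a = ?T (k - 1)" and "b = ?T k"
  have less: "?T i < ?T j" if "1 \<le> i" "i < j" "j \<le> k" for i j
    using strict_mono_onD[OF mono, of i j] that by auto
  have pos: "0 < ?T i" if "1 \<le> i" "i \<le> k" for i
    using less[of 1 i] pos1 that by (cases "i = 1") auto
  have ab: "0 < a" "a < b" "int n = a + b"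
    using less[of "k - 1" k] pos[of "k - 1"] k n by (auto simp: a_def b_def)
  have less_a: "?T i < a" if "1 \<le> i" "i \<le> k - 2" for i
    using less[of i "k - 1"] that k by (auto simp: a_def)
  have jump: "?T i \<in> ?D" if "1 \<le> i" "i \<le> k" for i
    using that by (auto simp: jumps_def)
  have jump_a: "a \<in> ?D" and jump_b: "b \<in> ?D"
    using jump[of "k - 1"] jump[of k] k by (auto simp: a_def b_def)
  have jump_le: "x \<le> b" if "x \<in> ?D" for x
  proof -
    obtain i where i: "i \<in> {1..k}" "x = ?T i"
      using \<open>x \<in> ?D\<close> by (auto simp: jumps_def)
    then show ?thesis
      using less[of i k] by (cases "i = k") (auto simp: b_def)
  qed
  have triple: "\<bar>x - y\<bar> \<in> ?D \<or> \<bar>x - z\<bar> \<in> ?D \<or> \<bar>y - z\<bar> \<in> ?D"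
    if "v \<in> {1..a + b}" "v + x \<in> {1..a + b}" "v + y \<in> {1..a + b}" "v + z \<in> {1..a + b}"
      "\<bar>x\<bar> \<in> ?D" "\<bar>y\<bar> \<in> ?D" "\<bar>z\<bar> \<in> ?D" "x \<noteq> y" "x \<noteq> z" "y \<noteq> z" for v x y z
  proof (rule toeplitz_claw_free_jumps[OF free, of v])
    show "1 \<le> t i" if "i \<in> {1..k}" for i
      using pos[of i] that by auto
  qed (use that ab in auto)
  have beyond: "b + x \<notin> ?D" if "0 < x" for x
    using jump_le[of "b + x"] that by auto
  have T_mult: "t j = j * t 1" if "1 \<le> j" "j \<le> k - 2" for j
  proof (rule difference_closed_imp_multiples[OF mono, of "k - 2"])
    fix i j assume ij: "1 \<le> i" "i < j" "j \<le> k - 2"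
    then have "i \<le> k" "j \<le> k" "1 \<le> j"
      using k by auto
    note facts = this pos[of i] pos[of j] less[of i j] less_a[of i] less_a[of j]
    have "\<bar>b - - ?T i\<bar> \<in> ?D \<or> \<bar>b - - ?T j\<bar> \<in> ?D \<or> \<bar>- ?T i - - ?T j\<bar> \<in> ?D"
      using triple[of a b "- ?T i" "- ?T j"] facts ij ab jump[of i] jump[of j] jump_b by auto
    then have "?T j - ?T i \<in> ?D"
      using beyond[of "?T i"] beyond[of "?T j"] facts ij ab by auto
    then obtain l where l: "l \<in> {1..k}" "?T j - ?T i = ?T l"
      by (auto simp: jumps_def)
    then have "t j - t i = t l"
      by linarith
    then show "\<exists>l\<in>{1..k}. t j - t i = t l"
      using l(1) by blast
  qed (use that pos1 in auto)
  define d m where "d = ?T 1" and "m = int k - 2"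
  have mult: "?T (nat j) = j * d \<and> 1 \<le> nat j \<and> nat j \<le> k - 2" if "j \<in> {1..m}" for j
    using T_mult[of "nat j"] that by (auto simp: m_def d_def nat_le_iff le_nat_iff)
  have jump_mult: "j * d \<in> ?D" "0 < j * d" "j * d < a" if "j \<in> {1..m}" for j
    using mult[OF that] jump[of "nat j"] pos[of "nat j"] less_a[of "nat j"] by auto
  have D_eq: "?D = (\<lambda>j. j * d) ` {1..m} \<union> {a, b}"
  proof
    show "?D \<subseteq> (\<lambda>j. j * d) ` {1..m} \<union> {a, b}"
    proof
      fix x assume "x \<in> ?D"
      then obtain i where i: "1 \<le> i" "i \<le> k" "x = ?T i"
        by (auto simp: jumps_def)
      then consider "i \<le> k - 2" | "i = k - 1" | "i = k"
        by linarith
      then show "x \<in> (\<lambda>j. j * d) ` {1..m} \<union> {a, b}"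
      proof cases
        case 1
        then have "x = int i * d" "int i \<in> {1..m}"
          using i T_mult[of i] k by (auto simp: m_def d_def)
        then show ?thesis by blast
      qed (use i in \<open>auto simp: a_def b_def\<close>)
    qed
  qed (use jump_mult jump_a jump_b in auto)
  have one: "1 \<in> {1..m}"
    using k by (auto simp: m_def)
  have "a = (m + 1) * d \<and> b \<in> {(m + 2) * d, (m + 3) * d}"
  proof (rule last_two_jumps)
    show "0 < d" "2 \<le> m" "a < b" "m * d < a"
      using pos1 k ab jump_mult[of m] by (auto simp: d_def m_def)
    show "b - a \<in> (\<lambda>j. j * d) ` {1..m} \<union> {a, b}"
    proof -
      have "\<bar>b - a\<bar> \<in> ?D \<or> \<bar>b - - d\<bar> \<in> ?D \<or> \<bar>a - - d\<bar> \<in> ?D"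
        using triple[of a b a "- d"] jump_mult[OF one] jump_a jump_b ab by auto
      then consider "b - a \<in> ?D" | "a + d \<in> ?D"
        using beyond[of d] jump_mult[OF one] ab by auto
      then show ?thesis
      proof cases
        case 2
        \<comment> \<open>The only jump above \<open>a\<close> is \<open>b\<close>, so that \<open>b - a = d\<close> is a jump as well.\<close>
        then have "b = a + d"
          using jump_mult[OF one] jump_mult(3) unfolding D_eq by fastforce
        then show ?thesis
          using one by force
      qed (simp add: D_eq)
    qed
    show "b - j * d \<in> (\<lambda>j. j * d) ` {1..m} \<union> {a, b} \<or> (i + j) * d \<in> (\<lambda>j. j * d) ` {1..m} \<union> {a, b}"
      if "i \<in> {1..m}" "j \<in> {1..m}" for i j
    proof -
      note facts = jump_mult[OF that(1)] jump_mult[OF that(2)]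
      have "\<bar>b - - (i * d)\<bar> \<in> ?D \<or> \<bar>b - j * d\<bar> \<in> ?D \<or> \<bar>- (i * d) - j * d\<bar> \<in> ?D"
        using triple[of a b "- (i * d)" "j * d"] facts jump_b ab by auto
      moreover have "\<bar>- (i * d) - j * d\<bar> = (i + j) * d"
        using facts by (auto simp: algebra_simps)
      moreover have "\<bar>b - - (i * d)\<bar> = b + i * d" "\<bar>b - j * d\<bar> = b - j * d"
        using facts ab by auto
      ultimately show ?thesis
        using beyond[of "i * d"] facts unfolding D_eq by metis
    qed
    show "2 * a \<in> (\<lambda>j. j * d) ` {1..m} \<union> {a, b} \<or> a - j * d \<in> (\<lambda>j. j * d) ` {1..m} \<union> {a, b}
        \<or> a + j * d \<in> (\<lambda>j. j * d) ` {1..m} \<union> {a, b}" if "j \<in> {1..m}" for j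
    proof -
      note facts = jump_mult[OF that]
      have "\<bar>a - - a\<bar> \<in> ?D \<or> \<bar>a - j * d\<bar> \<in> ?D \<or> \<bar>- a - j * d\<bar> \<in> ?D"
        using triple[of "a + 1" a "- a" "j * d"] facts jump_a ab by auto
      moreover have "\<bar>a - - a\<bar> = 2 * a" "\<bar>a - j * d\<bar> = a - j * d" "\<bar>- a - j * d\<bar> = a + j * d"
        using facts ab by auto
      ultimately show ?thesis
        unfolding D_eq by metis
    qed
  qed
  then have a_eq: "?T (k - 1) = (int k - 1) * ?T 1"
    and b_eq: "?T k \<in> {int k * ?T 1, (int k + 1) * ?T 1}"
    by (auto simp: a_def b_def d_def m_def)
  have "int (t (k - 1)) = int ((k - 1) * t 1)"
    using a_eq k by (simp add: of_nat_diff)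
  then have a_nat: "t (k - 1) = (k - 1) * t 1"
    by (simp only: of_nat_eq_iff)
  have "int (t k) = int (k * t 1) \<or> int (t k) = int ((k + 1) * t 1)"
    using b_eq by (auto simp: algebra_simps)
  then have "t k = k * t 1 \<or> t k = (k + 1) * t 1"
    by (simp only: of_nat_eq_iff)
  moreover have "t i = i * t 1" if "i \<in> {1..k - 1}" for i
    using that a_nat T_mult[of i] by (cases "i = k - 1") auto
  ultimately show ?thesis
    by blast
qed

section \<open>The characterization\<close>

theorem theorem3p7:
  fixes n k :: nat and t :: "nat \<Rightarrow> nat"
  assumes "4 \<le> k"
    and "1 \<le> t 1" and "strict_mono_on {1..k} t" and "t k < n"
    and "t (k - 1) + t k = n"
  shows "(claw_free (toeplitz_graph n k t) \<longleftrightarrow>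
            (\<forall>i\<in>{1..k - 1}. t i = i * t 1) \<and> t k \<in> {k * t 1, (k + 1) * t 1})
       \<and> (odd n \<longrightarrow>
            (claw_free (toeplitz_graph n k t) \<longleftrightarrow> (\<forall>i\<in>{1..k}. t i = i * t 1)))"
proof -
  let ?R = "(\<forall>i\<in>{1..k - 1}. t i = i * t 1) \<and> t k \<in> {k * t 1, (k + 1) * t 1}"
  have sum: "n = (k - 1) * t 1 + t k" if ?R
    using bspec[OF conjunct1[OF that], of "k - 1"] assms(1,5) by auto
  have double: "(k - 1) * t 1 + (k + 1) * t 1 = 2 * k * t 1"
  proof -
    have "(k - 1) + (k + 1) = 2 * k"
      using assms(1) by linarith
    then show ?thesis
      by (metis add_mult_distrib)
  qed
  have "claw_free (toeplitz_graph n k t)" if R: ?R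
  proof (rule toeplitz_multiples_claw_free)
    have "t k \<le> (k + 1) * t 1"
      using conjunct2[OF R] by auto
    then show "n \<le> 2 * k * t 1"
      using sum[OF R] double by linarith
  next
    show "t 1 dvd t k" "1 \<le> t k"
      using conjunct2[OF R] assms(1,2) by auto
    show "1 \<le> t 1"
      by (rule assms(2))
  qed (rule conjunct1[OF R])
  then have iff: "claw_free (toeplitz_graph n k t) \<longleftrightarrow> ?R"
    using toeplitz_claw_free_imp_multiples[OF assms(1,2,3,5)] by blast
  have "?R \<longleftrightarrow> (\<forall>i\<in>{1..k}. t i = i * t 1)" if "odd n"
  proof
    assume R: ?R
    have "t k \<noteq> (k + 1) * t 1"
    proof
      assume "t k = (k + 1) * t 1"
      then have "n = 2 * (k * t 1)"
        using sum[OF R] double by simp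
      then show False
        using \<open>odd n\<close> by simp
    qed
    then have tk: "t k = k * t 1"
      using R by blast
    show "\<forall>i\<in>{1..k}. t i = i * t 1"
    proof
      fix i assume "i \<in> {1..k}"
      then show "t i = i * t 1"
        using bspec[OF conjunct1[OF R], of i] tk by (cases "i = k") auto
    qed
  next
    assume all: "\<forall>i\<in>{1..k}. t i = i * t 1"
    have "t k = k * t 1"
      using bspec[OF all, of k] assms(1) by simp
    moreover have "\<forall>i\<in>{1..k - 1}. t i = i * t 1"
      by (intro ballI bspec[OF all]) auto
    ultimately show ?R
      by blast
  qed
  with iff show ?thesis
    by blast
qed

end
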